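(* Let $L:(0,\mathsf{m}_L)\to(0,\infty)$, $\mathsf{m}_L>0$, be an Osgood modulus of continuity, with $\mathcal{M}(z)=\int_z^{\mathsf{m}_L}\frac{dr}{L(r)}$ and $R(z)=\exp(-\mathcal{M}(z))$, and let $T>0$. There exists $r_0\in(0,1)$, $r_0\le \mathsf{m}_L$, depending only on $L$ and $T$, such that the following holds. Let $u:\mathbb{R}^d\times[0,T]\to\mathbb{R}^d$ be a bounded continuous velocity field with $$|u(x,t)-u(y,t)|\le\|u(t)\|_L\,L(|x-y|)\quad\text{for } 0<|x-y|<\mathsf{m}_L,\ t\in[0,T],\qquad \int_0^T\|u(s)\|_L\,ds<\infty,$$ let $\phi$ be its flow and set $\mu(t)=\exp\left(\int_0^t\|u(s)\|_L\,ds\right)$. Let $x_0\in\mathbb{R}^d$, $0<r<r_0$, and suppose that $$\theta_0(x)=F(\mathcal{M}(|x-x_0|))+b_0(x)\qquad\text{for } x\in B_r(x_0),$$ where $\|b_0\|_{L^\infty(B_r(x_0))}\le B_0<\infty$ and $F:\mathbb{R}\to\mathbb{R}$ is smooth with $[F]:=\sup_{|z|\ge1}|F'(z)|<\infty$. Then for $t\in[0,T]$ and $x\in B_{R^{-1}(\mu(t)^{-1}R(r))}(\phi(x_0,t))$, the solution $\theta$ of the transport equation $\partial_t\theta+u\cdot\nabla\theta=0$, $\theta|_{t=0}=\theta_0$, takes the form $$\theta(x,t)=F(\mathcal{M}(|x-\phi(x_0,t)|))+b(x,t),$$ where the remainder $b$ is a bounded function satisfying $$\|b(\cdot,t)\|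_{L^\infty\left(B_{R^{-1}(\mu(t)^{-1}R(r))}(\phi(x_0,t))\right)}\le\|b_0\|_{L^\infty(B_r(x_0))}+[F]\log\mu(t).$$
   Context: "Osgood modulus of continuity" means that $\mathcal{M}(z)$ is finite for $0<z<\mathsf{m}_L$ and $\lim_{z\to0^+}\mathcal{M}(z)=\infty$. Then $R$ is strictly increasing on $(0,\mathsf{m}_L)$ with $R(0^+)=0$ and $R(\mathsf{m}_L^-)=1$, and $R^{-1}$ denotes its inverse. $B_\rho(y)$ is the open ball of radius $\rho$ about $y$ in $\mathbb{R}^d$. The flow $\phi$ is the unique solution of $\frac{d}{dt}\phi(x,t)=u(\phi(x,t),t)$, $\phi(x,0)=x$; $\phi_t=\phi(\cdot,t)$ is a homeomorphism of $\mathbb{R}^d$. For Osgood velocity fields the integrable weak solution of the transport equation is unique and is given by $\theta(x,t)=\theta_0(\phi_t^{-1}(x))$; "the solution" means this function. Since $\mathcal{M}(0^+)=\infty$, the representations of $\theta_0$ and $\theta(\cdot,t)$ are understood away from the single points $x=x_0$ and $x=\phi(x_0,t)$ respectively.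
   Formalization: The L^∞ norms of b_0 and b(·,t) are taken as pointwise suprema rather than essential suprema, because an Osgood flow that is not divergence-free may map a null set to a set of positive measure, and the bound then fails for essential suprema. *)

theory Defs
  imports "HOL-Analysis.Analysis"
begin

text \<open>
  Points of \<open>\<real>\<^sup>d\<close> are the elements of the library's \<^const>\<open>Euclidean_space\<close> \<open>d\<close>, i.e. sequences
  vanishing from index \<open>d\<close> on. Taking \<open>d\<close> as a natural number rather than as a type allows it to be
  quantified after the radius \<open>r\<^sub>0\<close>, which may not depend on it.
\<close>

abbreviation Rn :: "nat \<Rightarrow> (nat \<Rightarrow> real) set" where
  "Rn d \<equiv> topspace (Euclidean_space d)"

definition edist :: "nat \<Rightarrow> (nat \<Rightarrow> real) \<Rightarrow> (nat \<Rightarrow> real) \<Rightarrow> real" where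
  "edist d x y = L2_set (\<lambda>i. x i - y i) {..<d}"

definition open_ball :: "nat \<Rightarrow> (nat \<Rightarrow> real) \<Rightarrow> real \<Rightarrow> (nat \<Rightarrow> real) set" where
  "open_ball d y \<rho> = {x \<in> Rn d. edist d x y < \<rho>}"

definition Mfun :: "(real \<Rightarrow> real) \<Rightarrow> real \<Rightarrow> real \<Rightarrow> real" where
  "Mfun L m z = (LBINT r:{z<..<m}. 1 / L r)"

definition Rfun :: "(real \<Rightarrow> real) \<Rightarrow> real \<Rightarrow> real \<Rightarrow> real" where
  "Rfun L m z = exp (- Mfun L m z)"

definition Rinv :: "(real \<Rightarrow> real) \<Rightarrow> real \<Rightarrow> real \<Rightarrow> real" where
  "Rinv L m = inv_into {0<..<m} (Rfun L m)"

text \<open>Only the values of \<open>L\<close> on \<open>(0, m)\<close> matter. Since \<open>1 / L\<close> is positive there, integrability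
  says exactly that \<open>\<M>(z)\<close> is finite.\<close>

definition osgood_modulus :: "real \<Rightarrow> (real \<Rightarrow> real) \<Rightarrow> bool" where
  "osgood_modulus m L \<longleftrightarrow>
     0 < m \<and>
     (\<forall>r\<in>{0<..<m}. 0 < L r) \<and>
     (\<forall>z\<in>{0<..<m}. set_integrable lborel {z<..<m} (\<lambda>r. 1 / L r)) \<and>
     filterlim (Mfun L m) at_top (at_right 0)"

text \<open>The least \<open>N \<in> [0, \<infinity>]\<close> with \<open>\<bar>v(x) - v(y)\<bar> \<le> N L(\<bar>x - y\<bar>)\<close> for \<open>0 < \<bar>x - y\<bar> < m\<close>.\<close>

definition osgood_seminorm ::
  "nat \<Rightarrow> real \<Rightarrow> (real \<Rightarrow> real) \<Rightarrow> ((nat \<Rightarrow> real) \<Rightarrow> (nat \<Rightarrow> real)) \<Rightarrow> ennreal" where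
  "osgood_seminorm d m L v =
     (SUP (x, y) \<in> {(x, y). x \<in> Rn d \<and> y \<in> Rn d \<and> 0 < edist d x y \<and> edist d x y < m}.
        ennreal (edist d (v x) (v y) / L (edist d x y)))"

lemma osgood_seminorm_bound:
  assumes "osgood_modulus m L" "x \<in> Rn d" "y \<in> Rn d" "0 < edist d x y" "edist d x y < m"
  shows "ennreal (edist d (v x) (v y)) \<le> osgood_seminorm d m L v * ennreal (L (edist d x y))"
proof -
  let ?l = "L (edist d x y)"
  have l: "0 < ?l"
    using assms by (auto simp: osgood_modulus_def)
  have n: "0 \<le> edist d (v x) (v y)"
    by (simp add: edist_def)
  have "ennreal (edist d (v x) (v y) / ?l) \<le> osgood_seminorm d m L v"
    unfolding osgood_seminorm_def using assms by (intro SUP_upper2[of "(x, y)"]) auto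
  then have "ennreal (edist d (v x) (v y) / ?l) * ennreal ?l
      \<le> osgood_seminorm d m L v * ennreal ?l"
    by (rule mult_right_mono) simp
  moreover have "ennreal (edist d (v x) (v y) / ?l) * ennreal ?l = ennreal (edist d (v x) (v y))"
    using l n by (simp add: ennreal_mult[symmetric])
  ultimately show ?thesis by simp
qed

lemma osgood_seminorm_least:
  assumes "osgood_modulus m L"
    and "\<And>x y. \<lbrakk>x \<in> Rn d; y \<in> Rn d; 0 < edist d x y; edist d x y < m\<rbrakk>
           \<Longrightarrow> edist d (v x) (v y) \<le> N * L (edist d x y)"
  shows "osgood_seminorm d m L v \<le> ennreal N"
proof -
  have "ennreal (edist d (v x) (v y) / L (edist d x y)) \<le> ennreal N"
    if "x \<in> Rn d" "y \<in> Rn d" "0 < edist d x y" "edist d x y < m" for x y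
  proof -
    have "0 < L (edist d x y)"
      using assms(1) that by (auto simp: osgood_modulus_def)
    then show ?thesis
      using assms(2)[OF that] by (intro ennreal_leI) (simp add: divide_le_eq)
  qed
  then show ?thesis
    unfolding osgood_seminorm_def by (auto intro!: SUP_least)
qed

definition velocity_integral ::
  "nat \<Rightarrow> real \<Rightarrow> (real \<Rightarrow> real) \<Rightarrow> ((nat \<Rightarrow> real) \<Rightarrow> real \<Rightarrow> (nat \<Rightarrow> real)) \<Rightarrow> real \<Rightarrow> ennreal" where
  "velocity_integral d m L u t = (\<integral>\<^sup>+ s\<in>{0..t}. osgood_seminorm d m L (\<lambda>x. u x s) \<partial>lborel)"

definition mu ::
  "nat \<Rightarrow> real \<Rightarrow> (real \<Rightarrow> real) \<Rightarrow> ((nat \<Rightarrow> real) \<Rightarrow> real \<Rightarrow> (nat \<Rightarrow> real)) \<Rightarrow> real \<Rightarrow> real" where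
  "mu d m L u t = exp (enn2real (velocity_integral d m L u t))"

definition osgood_velocity ::
  "nat \<Rightarrow> real \<Rightarrow> (real \<Rightarrow> real) \<Rightarrow> real \<Rightarrow> ((nat \<Rightarrow> real) \<Rightarrow> real \<Rightarrow> (nat \<Rightarrow> real)) \<Rightarrow> bool" where
  "osgood_velocity d m L T u \<longleftrightarrow>
     continuous_map (prod_topology (Euclidean_space d) (top_of_set {0..T})) (Euclidean_space d)
       (\<lambda>(x, t). u x t) \<and>
     (\<exists>K. \<forall>x\<in>Rn d. \<forall>t\<in>{0..T}. L2_set (u x t) {..<d} \<le> K) \<and>
     velocity_integral d m L u T < \<infinity>"

definition is_flow ::
  "nat \<Rightarrow> real \<Rightarrow> ((nat \<Rightarrow> real) \<Rightarrow> real \<Rightarrow> (nat \<Rightarrow> real))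
     \<Rightarrow> ((nat \<Rightarrow> real) \<Rightarrow> real \<Rightarrow> (nat \<Rightarrow> real)) \<Rightarrow> bool" where
  "is_flow d T u \<phi> \<longleftrightarrow>
     (\<forall>x\<in>Rn d. \<phi> x 0 = x \<and>
        (\<forall>t\<in>{0..T}. \<phi> x t \<in> Rn d \<and>
           (\<forall>i<d. ((\<lambda>s. \<phi> x s i) has_real_derivative u (\<phi> x t) t i) (at t within {0..T}))))"

definition transport_solution ::
  "nat \<Rightarrow> ((nat \<Rightarrow> real) \<Rightarrow> real \<Rightarrow> (nat \<Rightarrow> real)) \<Rightarrow> ((nat \<Rightarrow> real) \<Rightarrow> real)
     \<Rightarrow> (nat \<Rightarrow> real) \<Rightarrow> real \<Rightarrow> real" where
  "transport_solution d \<phi> \<theta>0 x t = \<theta>0 (inv_into (Rn d) (\<lambda>a. \<phi> a t) x)"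

text \<open>The functions concerned are defined pointwise and the flow need not preserve null sets, so
  the \<open>L\<^sup>\<infinity>\<close> norm is the supremum and not an essential supremum.\<close>

definition Linf_norm :: "'a set \<Rightarrow> ('a \<Rightarrow> real) \<Rightarrow> ennreal" where
  "Linf_norm S f = (SUP x\<in>S. ennreal \<bar>f x\<bar>)"

definition smooth_fun :: "(real \<Rightarrow> real) \<Rightarrow> bool" where
  "smooth_fun F \<longleftrightarrow> (\<forall>n. (deriv ^^ n) F differentiable_on UNIV)"

definition Fnorm :: "(real \<Rightarrow> real) \<Rightarrow> ennreal" where
  "Fnorm F = (SUP z\<in>{z. 1 \<le> \<bar>z\<bar>}. ennreal \<bar>deriv F z\<bar>)"

end

theory Submission
  imports Defs "HOL-Homology.Invariance_of_Domain"
begin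

text \<open>
  The function \<open>\<M>\<close> linearises the separation of flow lines. If \<open>\<delta>(s)\<close> is the distance between two
  trajectories, then \<open>\<bar>\<delta>'(s)\<bar> \<le> \<parallel>u(s)\<parallel>\<^sub>L L(\<delta>(s))\<close> as long as \<open>0 < \<delta> < m\<close>; since \<open>\<M>' = -1/L\<close>, the
  quantity \<open>\<M>(\<delta>(s))\<close> moves with speed at most \<open>\<parallel>u(s)\<parallel>\<^sub>L\<close>, and over \<open>[0, t]\<close> it changes by at most
  \<open>log \<mu>(t)\<close>. Hence replacing \<open>\<M>(\<bar>a - x\<^sub>0\<bar>)\<close> by \<open>\<M>(\<bar>\<phi>(a,t) - \<phi>(x\<^sub>0,t)\<bar>)\<close> inside \<open>F\<close> costs at most
  \<open>[F] log \<mu>(t)\<close>, provided both arguments lie where \<open>F'\<close> is controlled; this is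
  ensured by choosing \<open>r\<^sub>0 < m\<close> with \<open>\<M>(r\<^sub>0) > 1\<close>. The radius of the ball at time \<open>t\<close> is exactly the one whose
  \<open>\<M>\<close> exceeds \<open>\<M>(r)\<close> by \<open>log \<mu>(t)\<close>, so that trajectories ending in it have stayed within distance
  \<open>r\<close> of the trajectory of \<open>x\<^sub>0\<close> (\<open>sep_traced_back\<close>).

  Two points need more than this computation.

  First, \<open>L\<close> is merely measurable, so \<open>\<M>' = -1/L\<close> holds only almost everywhere, while \<open>\<delta>\<close> may
  dwell in the exceptional set and need not be monotone. Instead of a chain rule the proof uses the
  inequality \<open>\<integral>\<^bsub>\<delta>[a,b]\<^esub> 1/L \<le> \<integral>\<^sub>a\<^sup>b \<bar>\<delta>'\<bar> / L(\<delta>)\<close>, valid without injectivity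
  (\<open>Mfun_variation_le\<close>), on a time interval which \<open>\<delta>\<close> maps exactly onto \<open>[k, e]\<close>
  (\<open>crossing_interval\<close>). The outcome, \<open>crossing_cost\<close>, says that passing between the separations
  \<open>k < e\<close>, in either direction, costs at least \<open>\<M>(k) - \<M>(e)\<close>. As \<open>\<M>(0+) = \<infinity>\<close>, this
  gives injectivity and continuity of \<open>\<phi>\<^sub>t\<close> as well as the confinement above.

  Second, the solution \<open>\<theta>\<^sub>0(\<phi>\<^sub>t\<^sup>-\<^sup>1(x))\<close> carries information only if \<open>\<phi>\<^sub>t\<close> is onto. The image of the continuous
  injection \<open>\<phi>\<^sub>t\<close> is open by invariance of domain, and closed because \<open>\<phi>\<^sub>t\<close> moves points by a bounded
  amount; so it is the whole space, by connectedness (\<open>Rn_self_map_onto\<close>).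
\<close>

section \<open>The area inequality on the line\<close>

text \<open>
  Where \<open>g\<close> folds back, the image is covered several times by the right-hand side and counted
  once on the left; hence an inequality instead of the change-of-variables formula. The
  one-dimensional case is read off from \<^typ>\<open>real^1\<close>, where the determinant of the derivative is the derivative itself.
\<close>
lemma integral_on_image_ubound_real:
  fixes f g g' :: "real \<Rightarrow> real"
  assumes nonneg: "\<And>x. x \<in> S \<Longrightarrow> 0 \<le> f (g x)"
    and der: "\<And>x. x \<in> S \<Longrightarrow> (g has_real_derivative g' x) (at x within S)"
    and int: "(\<lambda>x. \<bar>g' x\<bar> * f (g x)) integrable_on S"
  shows "integral (g ` S) f \<le> integral S (\<lambda>x. \<bar>g' x\<bar> * f (g x))"
proof -
  let ?lift = "vec :: real \<Rightarrow> real^1"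
  let ?drop = "\<lambda>x::real^1. x $ 1"
  have "((\<lambda>x. vec (g (x $ 1))) has_derivative (*\<^sub>R) (g' z)) (at (vec z) within ?lift ` S)"
    if "z \<in> S" for z
    using der [OF that]
    by (simp add: has_real_derivative_iff_has_vector_derivative has_vector_derivative_def has_derivative_vector_1)
  then have der': "\<And>x. x \<in> ?lift ` S \<Longrightarrow>
        (?lift \<circ> g \<circ> ?drop has_derivative (*\<^sub>R) (g' (?drop x))) (at x within ?lift ` S)"
    by (auto simp: o_def)
  have "integral ((?lift \<circ> g \<circ> ?drop) ` ?lift ` S) (f \<circ> ?drop)
    \<le> integral (?lift ` S) (\<lambda>x. \<bar>det (matrix ((*\<^sub>R) (g' (?drop x)) :: real^1 \<Rightarrow> real^1))\<bar> * (f \<circ> ?drop) ((?lift \<circ> g \<circ> ?drop) x))"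
  proof (rule integral_on_image_ubound[OF _ der'])
    show "0 \<le> (f \<circ> ?drop) ((?lift \<circ> g \<circ> ?drop) x)" if "x \<in> ?lift ` S" for x
      using that nonneg by auto
    show "(\<lambda>x. \<bar>det (matrix ((*\<^sub>R) (g' (?drop x)) :: real^1 \<Rightarrow> real^1))\<bar> * (f \<circ> ?drop) ((?lift \<circ> g \<circ> ?drop) x))
        integrable_on ?lift ` S"
      (is "?G integrable_on _")
    proof -
      have "((?G \<circ> vec) has_integral integral S (\<lambda>x. \<bar>g' x\<bar> * f (g x))) (?drop ` ?lift ` S)"
        using int by (simp add: image_comp o_def has_integral_integral)
      then show ?thesis
        using has_integral_vec1_D has_integral_integrable by blast
    qed
  qed
  then show ?thesis
    unfolding integral_vec1_eq by (simp add: image_comp o_def)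
qed

section \<open>The function \<open>\<M>\<close> and the shrunken radius\<close>

lemma Mfun_eq_integral:
  assumes "osgood_modulus m L" "0 < z" "z < m"
  shows "(\<lambda>r. 1 / L r) integrable_on {z..m}" "Mfun L m z = integral {z..m} (\<lambda>r. 1 / L r)"
proof -
  have "set_integrable lborel {z<..<m} (\<lambda>r. 1 / L r)"
    using assms by (auto simp: osgood_modulus_def)
  note * = set_borel_integral_eq_integral[OF this]
  show "(\<lambda>r. 1 / L r) integrable_on {z..m}"
    using *(1) by (simp add: integrable_on_open_interval_real)
  show "Mfun L m z = integral {z..m} (\<lambda>r. 1 / L r)"
    unfolding Mfun_def *(2) by (simp add: integral_open_interval_real)
qed

lemma Mfun_diff:
  assumes "osgood_modulus m L" "0 < a" "a \<le> b" "b < m"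
  shows "Mfun L m a - Mfun L m b = integral {a..b} (\<lambda>r. 1 / L r)"
  using Henstock_Kurzweil_Integration.integral_combine[of a b m "\<lambda>r. 1 / L r"]
    Mfun_eq_integral[of m L a] Mfun_eq_integral[of m L b] assms
  by auto

lemma Mfun_strict_antimono:
  assumes os: "osgood_modulus m L" and "0 < a" "a < b" "b < m"
  shows "Mfun L m b < Mfun L m a"
proof -
  let ?f = "\<lambda>r. indicator {a..b} r *\<^sub>R (1 / L r)"
  have pos: "0 < 1 / L r" if "r \<in> {a..b}" for r
    using that assms by (auto simp: osgood_modulus_def)
  have si: "set_integrable lborel {a..b} (\<lambda>r. 1 / L r)"
    using assms
    by - (rule set_integrable_subset[where A = "{a/2<..<m}"], auto simp: osgood_modulus_def)
  have eq: "integral\<^sup>L lborel ?f = Mfun L m a - Mfun L m b"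
    using set_borel_integral_eq_integral(2)[OF si] Mfun_diff[of m L a b] assms
    by (simp add: set_lebesgue_integral_def)
  have nn: "AE r in lborel. 0 \<le> ?f r"
    by (rule AE_I2) (use pos in \<open>auto simp: indicator_def less_imp_le\<close>)
  have "integral\<^sup>L lborel ?f \<noteq> 0"
  proof
    assume "integral\<^sup>L lborel ?f = 0"
    then have "AE r in lborel. ?f r = 0"
      using integral_nonneg_eq_0_iff_AE[OF _ nn] si unfolding set_integrable_def by blast
    then have "AE r in lborel. r \<notin> {a..b}"
      by eventually_elim (use pos in \<open>force simp: indicator_def\<close>)
    then have "emeasure lborel {a..b} = 0"
      by (subst (asm) AE_iff_measurable[of "{a..b}"]) auto
    then show False using assms by simp
  qed
  moreover have "0 \<le> integral\<^sup>L lborel ?f"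
    using nn by (rule integral_nonneg_AE)
  ultimately show ?thesis using eq by linarith
qed

lemma Mfun_continuous_on:
  assumes "osgood_modulus m L" "0 < a" "b < m"
  shows "continuous_on {a..b} (Mfun L m)"
proof (cases "a \<le> b")
  case True
  have "continuous_on {a..b} (\<lambda>z. integral {z..m} (\<lambda>r. 1 / L r))"
    using assms True
    by (intro continuous_on_subset[OF indefinite_integral_continuous_1'[OF Mfun_eq_integral(1)[of m L a]]]) auto
  then show ?thesis
    using assms True by (subst continuous_on_cong[OF refl Mfun_eq_integral(2)]) auto
qed auto

lemma Mfun_large_near_0:
  assumes "osgood_modulus m L" "0 < e"
  obtains z where "0 < z" "z < e" "C < Mfun L m z"
proof -
  have "eventually (\<lambda>z. C < Mfun L m z) (at_right 0)"
    using assms by (auto simp: osgood_modulus_def filterlim_at_top_dense)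
  then obtain b where "0 < b" "\<forall>z>0. z < b \<longrightarrow> C < Mfun L m z"
    unfolding eventually_at_right_field by blast
  then show thesis
    using that[of "min b e / 2"] \<open>0 < e\<close> by simp
qed

text \<open>
  In terms of \<open>\<M>\<close>, dividing \<open>R = exp(-\<M>)\<close> by \<open>\<mu>\<close> adds \<open>log \<mu>\<close>. That the new value is attained at
  all, so that the inverse is not an arbitrary default, follows from continuity and \<open>\<M>(0+) = \<infinity>\<close>.
\<close>
lemma Rinv_shrunk_radius:
  assumes os: "osgood_modulus m L" and "0 < r" "r < m" "1 \<le> \<mu>"
  defines "\<rho> \<equiv> Rinv L m (Rfun L m r / \<mu>)"
  shows "0 < \<rho>" "\<rho> < m" "Mfun L m \<rho> = Mfun L m r + ln \<mu>"
proof -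
  obtain z where z: "0 < z" "z < r" "Mfun L m r + ln \<mu> < Mfun L m z"
    using Mfun_large_near_0[OF os \<open>0 < r\<close>] .
  have "\<exists>y\<ge>z. y \<le> r \<and> Mfun L m y = Mfun L m r + ln \<mu>"
    using z assms by (intro IVT2' Mfun_continuous_on) auto
  then obtain y where "z \<le> y" "y \<le> r" and My: "Mfun L m y = Mfun L m r + ln \<mu>"
    by blast
  then have y: "y \<in> {0<..<m}"
    using z \<open>r < m\<close> by simp
  have R: "Rfun L m v = Rfun L m r / \<mu> \<longleftrightarrow> Mfun L m v = Mfun L m r + ln \<mu>" for v
  proof -
    have "Rfun L m r / \<mu> = exp (- (Mfun L m r + ln \<mu>))"
      using \<open>1 \<le> \<mu>\<close> by (simp add: Rfun_def exp_minus exp_diff inverse_eq_divide)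
    then show ?thesis by (auto simp: Rfun_def)
  qed
  have "Rfun L m r / \<mu> \<in> Rfun L m ` {0<..<m}"
    using y My R by (metis image_eqI)
  then have "\<rho> \<in> {0<..<m}" "Rfun L m \<rho> = Rfun L m r / \<mu>"
    unfolding \<rho>_def Rinv_def by (rule inv_into_into, rule f_inv_into_f)
  then show "0 < \<rho>" "\<rho> < m" "Mfun L m \<rho> = Mfun L m r + ln \<mu>"
    using R by auto
qed

section \<open>Cost of changing the separation\<close>

text \<open>
  Take the first time \<open>b\<close> at which \<open>f\<close> reaches \<open>e\<close>, and then the last time \<open>a\<close> before \<open>b\<close> at which
  \<open>f\<close> is still at most \<open>k\<close>.
\<close>
lemma crossing_interval_up:
  fixes f :: "real \<Rightarrow> real"
  assumes cont: "continuous_on {p..q} f" and "p \<le> q" "f p \<le> k" "k < e" "e \<le> f q"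
  obtains a b where "p \<le> a" "a \<le> b" "b \<le> q" "f ` {a..b} = {k..e}"
proof -
  have "compact ({p..q} \<inter> f -` {e..})"
    unfolding compact_eq_bounded_closed using cont
    by (auto intro: bounded_Int continuous_closed_preimage)
  moreover have "q \<in> {p..q} \<inter> f -` {e..}" using assms by simp
  ultimately obtain b where b0: "b \<in> {p..q} \<inter> f -` {e..}" "\<forall>s\<in>{p..q} \<inter> f -` {e..}. b \<le> s"
    using compact_attains_inf[of "{p..q} \<inter> f -` {e..}"] by blast
  then have b: "b \<in> {p..q}" "e \<le> f b" "\<And>s. s \<in> {p..q} \<Longrightarrow> e \<le> f s \<Longrightarrow> b \<le> s"
    by simp_all
  have contb: "continuous_on {p..b} f"
    using cont by (rule continuous_on_subset) (use b in auto)
  obtain c where "p \<le> c" "c \<le> b" "f c = e"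
    using IVT'[of f p e b, OF _ _ _ contb] b assms by auto
  then have "c = b" using b(1) b(3)[of c] by simp
  then have fb: "f b = e" using \<open>f c = e\<close> by simp
  have "compact ({p..b} \<inter> f -` {..k})"
    unfolding compact_eq_bounded_closed using contb
    by (auto intro: bounded_Int continuous_closed_preimage)
  moreover have "p \<in> {p..b} \<inter> f -` {..k}" using assms b by simp
  ultimately obtain a where a0: "a \<in> {p..b} \<inter> f -` {..k}" "\<forall>s\<in>{p..b} \<inter> f -` {..k}. s \<le> a"
    using compact_attains_sup[of "{p..b} \<inter> f -` {..k}"] by blast
  then have a: "a \<in> {p..b}" "f a \<le> k" "\<And>s. s \<in> {p..b} \<Longrightarrow> f s \<le> k \<Longrightarrow> s \<le> a"
    by simp_all
  have conta: "continuous_on {a..b} f"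
    using contb by (rule continuous_on_subset) (use a in auto)
  have onto: "y \<in> f ` {a..b}" if "y \<in> {k..e}" for y
    using IVT'[of f a y b, OF _ _ _ conta] a fb that by auto
  have fa: "f a = k"
  proof -
    obtain s where s: "s \<in> {a..b}" "f s = k" using onto[of k] \<open>k < e\<close> by auto
    then have "s = a" using a(3)[of s] a(1) by auto
    with s show ?thesis by simp
  qed
  have "f s \<in> {k..e}" if "s \<in> {a..b}" for s
  proof -
    have "k < f s" if "s \<noteq> a"
      using a(3)[of s] \<open>s \<in> {a..b}\<close> a(1) that by (auto simp: not_le[symmetric])
    moreover have "f s < e" if "s \<noteq> b"
      using b(3)[of s] \<open>s \<in> {a..b}\<close> a(1) b(1) that by (auto simp: not_le[symmetric])
    ultimately show ?thesis
      using fa fb \<open>k < e\<close> by (cases "s = a"; cases "s = b") auto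
  qed
  with onto show thesis
    using a b by (intro that[of a b]) auto
qed

text \<open>
  The times \<open>p\<close> and \<open>q\<close> may come in either order: the estimates are later needed both forwards
  (continuity of the flow map) and backwards (its injectivity, and confinement near \<open>x\<^sub>0\<close>).
\<close>
lemma crossing_interval:
  fixes f :: "real \<Rightarrow> real"
  assumes cont: "continuous_on {0..t} f" and "p \<in> {0..t}" "q \<in> {0..t}" "f p \<le> k" "k < e" "e \<le> f q"
  obtains a b where "0 \<le> a" "a \<le> b" "b \<le> t" "f ` {a..b} = {k..e}"
proof (cases "p \<le> q")
  case True
  have "continuous_on {p..q} f"
    using cont by (rule continuous_on_subset) (use assms in auto)
  then obtain a b where "p \<le> a" "a \<le> b" "b \<le> q" "f ` {a..b} = {k..e}"
    using crossing_interval_up[of p q f k e] True assms(4-6) by blast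
  then show thesis
    using assms(2,3) by (intro that[of a b]) auto
next
  case False
  have "continuous_on {q..p} (\<lambda>s. - f s)"
    using cont by (intro continuous_on_minus) (rule continuous_on_subset, use assms in auto)
  then obtain a b where ab: "q \<le> a" "a \<le> b" "b \<le> p" "(\<lambda>s. - f s) ` {a..b} = {-e..-k}"
    using crossing_interval_up[of q p "\<lambda>s. - f s" "-e" "-k"] False assms(4-6)
    by (smt (verit, best) neg_le_iff_le neg_less_iff_less)
  have "f ` {a..b} = uminus ` (\<lambda>s. - f s) ` {a..b}"
    by (simp add: image_image)
  also have "\<dots> = {k..e}"
    by (simp add: ab(4))
  finally show thesis
    using ab assms by (intro that[of a b]) auto
qed

text \<open>
  Pointwise \<open>\<bar>D\<bar> / L(\<delta>) \<le> N\<close>, so the area inequality turns the bound on the integral of \<open>N\<close> into one on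
  the integral of \<open>1/L\<close> over \<open>\<delta>[a,b] = [k,e]\<close>, which is the difference of \<open>\<M>\<close>. Only the measurable
  function \<open>\<bar>D\<bar> / L(\<delta>)\<close> is ever integrated in the classical sense. The nonnegative integral of \<open>N\<close>,
  which may be non-measurable or infinite at some times, enters through monotonicity alone.
\<close>
lemma Mfun_variation_le:
  fixes \<delta> D :: "real \<Rightarrow> real" and N :: "real \<Rightarrow> ennreal"
  assumes os: "osgood_modulus m L" and k: "0 < k" "k < e" "e < m"
    and img: "\<delta> ` {a..b} = {k..e}"
    and der: "\<And>s. s \<in> {a..b} \<Longrightarrow> (\<delta> has_real_derivative D s) (at s within {a..b})"
    and contD: "continuous_on {a..b} D"
    and DN: "\<And>s. s \<in> {a..b} \<Longrightarrow> ennreal \<bar>D s\<bar> \<le> N s * ennreal (L (\<delta> s))"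
    and N: "(\<integral>\<^sup>+ s\<in>{a..b}. N s \<partial>lborel) \<le> ennreal \<Lambda>" and "0 \<le> \<Lambda>"
  shows "Mfun L m k - Mfun L m e \<le> \<Lambda>"
proof -
  have \<delta>ke: "\<delta> s \<in> {k..e}" if "s \<in> {a..b}" for s
    using img that by blast
  have Lpos: "0 < L (\<delta> s)" if "s \<in> {a..b}" for s
    using \<delta>ke[OF that] os k by (auto simp: osgood_modulus_def)
  \<comment> \<open>Globally Borel measurable copies of \<open>\<delta>\<close>, \<open>D\<close> and \<open>1/L\<close>: the originals are controlled only on
    \<open>[a,b]\<close> and \<open>(0,m)\<close>, so their composition is otherwise not known to be measurable.\<close>
  define \<delta>' where "\<delta>' = (\<lambda>s. indicator {a..b} s *\<^sub>R \<delta> s)"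
  define D' where "D' = (\<lambda>s. indicator {a..b} s *\<^sub>R D s)"
  define h where "h = (\<lambda>r. indicator {k/2<..<m} r *\<^sub>R (1 / L r))"
  have "continuous_on {a..b} \<delta>"
    using der by (rule DERIV_continuous_on)
  then have m1: "\<delta>' \<in> borel_measurable borel"
    unfolding \<delta>'_def by (intro borel_measurable_continuous_on_indicator) auto
  have m2: "D' \<in> borel_measurable borel"
    unfolding D'_def using contD by (intro borel_measurable_continuous_on_indicator) auto
  have "set_integrable lborel {k/2<..<m} (\<lambda>r. 1 / L r)"
    using os k by (auto simp: osgood_modulus_def)
  then have m3: "h \<in> borel_measurable borel"
    unfolding h_def set_integrable_def using borel_measurable_integrable by fastforce
  define G where "G = (\<lambda>s. \<bar>D' s\<bar> * h (\<delta>' s))"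
  have mG: "G \<in> borel_measurable lborel"
    unfolding G_def using m1 m2 measurable_compose[OF m1 m3] by measurable
  have G_in: "G s = \<bar>D s\<bar> * (1 / L (\<delta> s))" if "s \<in> {a..b}" for s
    using \<delta>ke[OF that] that k by (auto simp: G_def D'_def \<delta>'_def h_def)
  have G_out: "G s = 0" if "s \<notin> {a..b}" for s
    using that by (simp add: G_def D'_def)
  have G0: "0 \<le> G s" for s
    using Lpos[of s] G_in[of s] G_out[of s] by (cases "s \<in> {a..b}") (auto simp: less_imp_le)
  have GN: "ennreal (G s) \<le> N s * indicator {a..b} s" for s
  proof (cases "s \<in> {a..b}")
    case True
    have "ennreal (G s) = ennreal \<bar>D s\<bar> * ennreal (1 / L (\<delta> s))"
      using True Lpos[OF True] by (simp add: G_in ennreal_mult[symmetric])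
    also have "\<dots> \<le> N s * ennreal (L (\<delta> s)) * ennreal (1 / L (\<delta> s))"
      by (rule mult_right_mono[OF DN[OF True]]) simp
    also have "\<dots> = N s"
      using Lpos[OF True] by (simp add: mult.assoc ennreal_mult[symmetric])
    finally show ?thesis using True by simp
  qed (simp add: G_out)
  have le: "(\<integral>\<^sup>+ s. ennreal (G s) \<partial>lborel) \<le> ennreal \<Lambda>"
    by (rule order.trans[OF nn_integral_mono N]) (rule GN)
  have intG: "integrable lborel G"
    using mG le G0 by (intro integrableI_nonneg) (auto intro: le_less_trans[OF le])
  have eqG: "(\<lambda>s. indicator {a..b} s *\<^sub>R G s) = G"
  proof
    show "indicator {a..b} s *\<^sub>R G s = G s" for s
      by (cases "s \<in> {a..b}") (use G_out[of s] in simp_all)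
  qed
  have siG: "set_integrable lborel {a..b} G"
    using intG unfolding set_integrable_def eqG .
  have "Mfun L m k - Mfun L m e = integral (\<delta> ` {a..b}) (\<lambda>r. 1 / L r)"
    using Mfun_diff[OF os, of k e] k by (simp add: img)
  also have "\<dots> \<le> integral {a..b} (\<lambda>s. \<bar>D s\<bar> * (1 / L (\<delta> s)))"
  proof (rule integral_on_image_ubound_real[OF _ der])
    show "(\<lambda>s. \<bar>D s\<bar> * (1 / L (\<delta> s))) integrable_on {a..b}"
      by (rule integrable_eq[OF set_borel_integral_eq_integral(1)[OF siG] G_in])
  qed (use Lpos in \<open>auto simp: less_imp_le\<close>)
  also have "\<dots> = integral {a..b} G"
    using G_in by (intro integral_cong) auto
  also have "\<dots> = integral\<^sup>L lborel G"
    using set_borel_integral_eq_integral(2)[OF siG] unfolding set_lebesgue_integral_def eqG by (rule sym)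
  also have "\<dots> \<le> \<Lambda>"
    using le nn_integral_eq_integral[OF intG] G0 \<open>0 \<le> \<Lambda>\<close> by simp
  finally show ?thesis .
qed

section \<open>Distances and self-maps of \<open>\<real>\<^sup>d\<close>\<close>

lemma edist_nonneg: "0 \<le> edist d x y"
  by (simp add: edist_def)

lemma edist_eq_0_iff:
  assumes "x \<in> Rn d" "y \<in> Rn d"
  shows "edist d x y = 0 \<longleftrightarrow> x = y"
proof
  assume "edist d x y = 0"
  then have "x i = y i" if "i < d" for i
    using that by (simp add: edist_def L2_set_eq_0_iff)
  moreover have "x i = y i" if "\<not> i < d" for i
    using that assms by (simp add: topspace_Euclidean_space)
  ultimately show "x = y" by blast
qed (simp add: edist_def L2_set_def)

lemma abs_coordinate_le_edist: "i < d \<Longrightarrow> \<bar>x i - y i\<bar> \<le> edist d x y"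
  using member_le_L2_set[of "{..<d}" i "\<lambda>i. \<bar>x i - y i\<bar>"] by (simp add: edist_def L2_set_def)

lemma edist_has_derivative:
  assumes der: "\<And>i. i < d \<Longrightarrow> ((\<lambda>s. x s i) has_real_derivative v i) (at s within S')"
      "\<And>i. i < d \<Longrightarrow> ((\<lambda>s. y s i) has_real_derivative w i) (at s within S')"
    and pos: "0 < edist d (x s) (y s)"
  shows "((\<lambda>s. edist d (x s) (y s)) has_real_derivative
      (\<Sum>i<d. (x s i - y s i) * (v i - w i)) / edist d (x s) (y s)) (at s within S')"
proof -
  let ?Q = "\<lambda>s. \<Sum>i<d. (x s i - y s i)\<^sup>2"
  have ed: "edist d (x s) (y s) = sqrt (?Q s)" for s
    by (simp add: edist_def L2_set_def)
  define S where "S = (\<Sum>i<d. (x s i - y s i) * (v i - w i))"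
  have "(?Q has_real_derivative (\<Sum>i<d. 2 * ((x s i - y s i) * (v i - w i)))) (at s within S')"
  proof (rule DERIV_sum)
    fix i assume "i \<in> {..<d}"
    then have "((\<lambda>s. x s i - y s i) has_real_derivative v i - w i) (at s within S')"
      by (intro DERIV_diff der) auto
    from DERIV_power[OF this, of 2]
    show "((\<lambda>s. (x s i - y s i)\<^sup>2) has_real_derivative 2 * ((x s i - y s i) * (v i - w i))) (at s within S')"
      by (simp add: mult_ac)
  qed
  then have "(?Q has_real_derivative 2 * S) (at s within S')"
    unfolding S_def sum_distrib_left .
  moreover have "0 < ?Q s"
    using pos by (simp add: ed)
  ultimately have "((\<lambda>s. sqrt (?Q s)) has_real_derivative inverse (sqrt (?Q s)) / 2 * (2 * S)) (at s within S')"
    by (intro DERIV_chain2[OF DERIV_real_sqrt])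
  then show ?thesis
    unfolding ed S_def[symmetric] by (rule DERIV_cong) (simp add: inverse_eq_divide)
qed

text \<open>
  By Cauchy--Schwarz, two points separate no faster than their velocities differ.
\<close>
lemma edist_derivative_le:
  assumes "0 < edist d x y"
  shows "\<bar>(\<Sum>i<d. (x i - y i) * (v i - w i)) / edist d x y\<bar> \<le> edist d v w"
proof -
  have "\<bar>\<Sum>i<d. (x i - y i) * (v i - w i)\<bar> \<le> (\<Sum>i<d. \<bar>x i - y i\<bar> * \<bar>v i - w i\<bar>)"
    by (rule order.trans[OF sum_abs]) (simp add: abs_mult)
  also have "\<dots> \<le> edist d x y * edist d v w"
    unfolding edist_def by (rule L2_set_mult_ineq)
  finally show ?thesis
    using assms by (simp add: divide_le_eq mult.commute)
qed

text \<open>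
  The image is open by invariance of domain. It is closed because preimages of a convergent sequence
  remain, up to the bounded displacement, near the limit: they lie in a compact box \<open>K\<close>, and \<open>f(K)\<close>
  is closed. Connectedness of \<open>\<real>\<^sup>d\<close> does the rest.
\<close>
lemma Rn_self_map_onto:
  assumes cont: "continuous_on (Rn d) f" and into: "f ` Rn d \<subseteq> Rn d" and inj: "inj_on f (Rn d)"
    and near: "\<And>a i. a \<in> Rn d \<Longrightarrow> i < d \<Longrightarrow> \<bar>f a i - a i\<bar> \<le> C"
  shows "f ` Rn d = Rn d"
proof -
  let ?E = "Euclidean_space d"
  have "continuous_map (subtopology ?E (Rn d)) ?E f"
    unfolding cm_Euclidean_space_iff_continuous_on
    using cont into by (simp add: image_subset_iff_funcset)
  then have "openin ?E (f ` Rn d)"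
    by (rule invariance_of_domain_Euclidean_space[OF openin_topspace _ inj])
  moreover have "closed (f ` Rn d)"
    unfolding closed_sequential_limits
  proof (intro allI impI, elim conjE)
    fix X l
    assume X: "\<forall>n. X n \<in> f ` Rn d" and lim: "X \<longlonglongrightarrow> l"
    from X have "\<forall>n. \<exists>a. a \<in> Rn d \<and> X n = f a"
      by (auto simp: image_iff Bex_def)
    then obtain a where a: "\<And>n. a n \<in> Rn d" "\<And>n. X n = f (a n)"
      by (auto dest!: choice)
    define K where "K = PiE UNIV (\<lambda>i. if i < d then {l i - (C + 1)..l i + (C + 1)} else {0})"
    have KR: "K \<subseteq> Rn d"
    proof
      fix y assume "y \<in> K"
      then have y: "y i \<in> (if i < d then {l i - (C + 1)..l i + (C + 1)} else {0})" for i
        unfolding K_def by (rule PiE_mem) simp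
      have "y i = 0" if "d \<le> i" for i
        using y[of i] that by simp
      then show "y \<in> Rn d"
        by (simp add: topspace_Euclidean_space)
    qed
    have "compactin euclideanreal (if i < d then {l i - (C + 1)..l i + (C + 1)} else {0})" for i
      by simp
    then have "compactin (powertop_real UNIV) K"
      unfolding K_def compactin_PiE by blast
    then have "compact K"
      by (simp add: euclidean_product_topology)
    then have "compact (f ` K)"
      using cont KR by (intro compact_continuous_image) (auto intro: continuous_on_subset)
    moreover have "eventually (\<lambda>n. X n \<in> f ` K) sequentially"
    proof -
      have "eventually (\<lambda>n. \<bar>X n i - l i\<bar> < 1) sequentially" for i
      proof -
        have "continuous_on UNIV (\<lambda>x::nat \<Rightarrow> real. x i)"
          by (rule continuous_on_product_coordinates)
        then have "(\<lambda>n. X n i) \<longlonglongrightarrow> l i"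
          using lim by (rule continuous_on_tendsto_compose) auto
        then show ?thesis
          by (auto dest!: tendstoD[where e = 1] simp: dist_real_def)
      qed
      then have "eventually (\<lambda>n. \<forall>i\<in>{..<d}. \<bar>X n i - l i\<bar> < 1) sequentially"
        by (simp add: eventually_ball_finite)
      then show ?thesis
      proof eventually_elim
        case (elim n)
        have "a n i \<in> {l i - (C + 1)..l i + (C + 1)}" if "i < d" for i
          using elim[rule_format, of i] near[OF a(1)[of n] that] that a(2)[of n] by auto
        moreover have "a n i = 0" if "\<not> i < d" for i
          using a(1)[of n] that by (simp add: topspace_Euclidean_space)
        ultimately have "a n \<in> K"
          by (auto simp: K_def PiE_iff)
        then show ?case using a(2) by blast
      qed
    qed
    ultimately have "l \<in> f ` K"
      using lim by (intro Lim_in_closed_set[of "f ` K" X sequentially l]) (auto intro: compact_imp_closed)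
    then show "l \<in> f ` Rn d" using KR by blast
  qed
  then have "closedin ?E (f ` Rn d)"
    using into by (simp add: closedin_Euclidean_space_iff)
  moreover have "f ` Rn d \<noteq> {}"
    by (auto simp: topspace_Euclidean_space)
  ultimately show ?thesis
    using connected_Euclidean_space[of d] unfolding connected_space_clopen_in by blast
qed

section \<open>Flow lines of an Osgood velocity field\<close>

locale osgood_flow =
  fixes d :: nat and m :: real and L :: "real \<Rightarrow> real" and T :: real
    and u \<phi> :: "(nat \<Rightarrow> real) \<Rightarrow> real \<Rightarrow> (nat \<Rightarrow> real)"
  assumes modulus: "osgood_modulus m L"
    and T_pos: "0 < T"
    and velocity: "osgood_velocity d m L T u"
    and flow: "is_flow d T u \<phi>"
begin

lemma m_pos: "0 < m"
  using modulus by (simp add: osgood_modulus_def)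

lemma flow_0: "a \<in> Rn d \<Longrightarrow> \<phi> a 0 = a"
  using flow by (simp add: is_flow_def)

lemma flow_in_Rn: "a \<in> Rn d \<Longrightarrow> s \<in> {0..T} \<Longrightarrow> \<phi> a s \<in> Rn d"
  using flow unfolding is_flow_def by blast

lemma flow_derivative:
  "a \<in> Rn d \<Longrightarrow> s \<in> {0..T} \<Longrightarrow> i < d \<Longrightarrow>
    ((\<lambda>s. \<phi> a s i) has_real_derivative u (\<phi> a s) s i) (at s within {0..T})"
  using flow unfolding is_flow_def by blast

lemma flow_continuous_on_time:
  assumes "a \<in> Rn d" "i < d"
  shows "continuous_on {0..T} (\<lambda>s. \<phi> a s i)"
  using flow_derivative[OF assms(1) _ assms(2)] by (rule DERIV_continuous_on)

lemma velocity_continuous_along_flow: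
  assumes a: "a \<in> Rn d"
  shows "continuous_on {0..T} (\<lambda>s. u (\<phi> a s) s i)"
proof -
  let ?I = "top_of_set {0..T}"
  have "continuous_map ?I euclideanreal (\<lambda>s. \<phi> a s i)" for i
  proof (cases "i < d")
    case False
    then have "\<phi> a s i = 0" if "s \<in> {0..T}" for s
      using flow_in_Rn[OF a that] by (simp add: topspace_Euclidean_space)
    then have "continuous_on {0..T} (\<lambda>s. \<phi> a s i)"
      by (intro continuous_on_eq[OF continuous_on_const[of _ 0]]) simp
    then show ?thesis by simp
  qed (use flow_continuous_on_time[OF a] in simp)
  then have "continuous_map ?I (Euclidean_space d) (\<phi> a)"
    using flow_in_Rn[OF a]
    by (auto simp: Euclidean_space_def continuous_map_in_subtopology continuous_map_componentwise_UNIV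
        topspace_Euclidean_space)
  then have "continuous_map ?I (prod_topology (Euclidean_space d) ?I) (\<lambda>s. (\<phi> a s, s))"
    by (intro continuous_map_pairedI) auto
  moreover have "continuous_map (prod_topology (Euclidean_space d) ?I) (Euclidean_space d) (\<lambda>(x, t). u x t)"
    using velocity by (simp add: osgood_velocity_def)
  ultimately have "continuous_map ?I (Euclidean_space d) (\<lambda>s. u (\<phi> a s) s)"
    by (auto dest: continuous_map_compose simp: o_def)
  then have "continuous_map ?I euclideanreal (\<lambda>s. u (\<phi> a s) s i)"
    by (simp add: Euclidean_space_def continuous_map_in_subtopology continuous_map_componentwise_UNIV)
  then show ?thesis by simp
qed

abbreviation sep :: "(nat \<Rightarrow> real) \<Rightarrow> (nat \<Rightarrow> real) \<Rightarrow> real \<Rightarrow> real" where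
  "sep a b s \<equiv> edist d (\<phi> a s) (\<phi> b s)"

lemma sep_continuous:
  assumes "a \<in> Rn d" "b \<in> Rn d"
  shows "continuous_on {0..T} (sep a b)"
  unfolding edist_def L2_set_def
  using flow_continuous_on_time assms by (intro continuous_intros) auto

lemma velocity_integral_mono: "s \<le> t \<Longrightarrow> velocity_integral d m L u s \<le> velocity_integral d m L u t"
  unfolding velocity_integral_def
  by (intro nn_integral_mono mult_left_mono) (auto simp: indicator_def)

lemma velocity_integral_finite: "t \<le> T \<Longrightarrow> velocity_integral d m L u t < \<infinity>"
  using velocity_integral_mono velocity by (auto simp: osgood_velocity_def intro: le_less_trans)

lemma ennreal_ln_mu: "t \<le> T \<Longrightarrow> ennreal (ln (mu d m L u t)) = velocity_integral d m L u t"
  using velocity_integral_finite by (simp add: mu_def)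

lemma ln_mu_nonneg: "0 \<le> ln (mu d m L u t)"
  by (simp add: mu_def)

lemma ln_mu_mono: "s \<le> t \<Longrightarrow> t \<le> T \<Longrightarrow> ln (mu d m L u s) \<le> ln (mu d m L u t)"
  using velocity_integral_mono velocity_integral_finite by (simp add: mu_def enn2real_mono)

text \<open>
  The form in which the differential inequality for the separation is used below. The
  flow lines may meet outside the crossing, so that uniqueness can be deduced from it.
\<close>
lemma crossing_cost:
  assumes "a \<in> Rn d" "b \<in> Rn d" "t \<in> {0..T}" "p \<in> {0..t}" "q \<in> {0..t}"
    and "sep a b p \<le> k" "0 < k" "k < e" "e < m" "e \<le> sep a b q"
  shows "Mfun L m k - Mfun L m e \<le> ln (mu d m L u t)"
proof -
  have "continuous_on {0..t} (sep a b)"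
    using sep_continuous[OF assms(1,2)] by (rule continuous_on_subset) (use assms in auto)
  then obtain p' q' where pq: "0 \<le> p'" "p' \<le> q'" "q' \<le> t" "sep a b ` {p'..q'} = {k..e}"
    using crossing_interval[of t "sep a b" p q k e] assms by blast
  have I: "s \<in> {0..T}" if "s \<in> {p'..q'}" for s
    using that pq assms by auto
  have range: "0 < sep a b s" "sep a b s < m" if "s \<in> {p'..q'}" for s
  proof -
    have "sep a b s \<in> {k..e}" using pq(4) that by blast
    then show "0 < sep a b s" "sep a b s < m" using assms(7,9) by auto
  qed
  define D where "D s = (\<Sum>i<d. (\<phi> a s i - \<phi> b s i) * (u (\<phi> a s) s i - u (\<phi> b s) s i)) / sep a b s" for s
  show ?thesis
  proof (rule Mfun_variation_le[where D = D and N = "\<lambda>s. osgood_seminorm d m L (\<lambda>x. u x s)",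
        OF modulus \<open>0 < k\<close> \<open>k < e\<close> \<open>e < m\<close> pq(4)])
    fix s assume s: "s \<in> {p'..q'}"
    have "(sep a b has_real_derivative D s) (at s within {0..T})"
      unfolding D_def using assms I[OF s] range[OF s]
      by (intro edist_has_derivative flow_derivative) auto
    then show "(sep a b has_real_derivative D s) (at s within {p'..q'})"
      by (rule DERIV_subset) (use I in auto)
    have "\<bar>D s\<bar> \<le> edist d (u (\<phi> a s) s) (u (\<phi> b s) s)"
      unfolding D_def using range[OF s] by (intro edist_derivative_le)
    then have "ennreal \<bar>D s\<bar> \<le> ennreal (edist d (u (\<phi> a s) s) (u (\<phi> b s) s))"
      by (rule ennreal_leI)
    also have "\<dots> \<le> osgood_seminorm d m L (\<lambda>x. u x s) * ennreal (L (sep a b s))"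
      using osgood_seminorm_bound[OF modulus, of "\<phi> a s" d "\<phi> b s" "\<lambda>x. u x s"]
        flow_in_Rn assms I[OF s] range[OF s] by simp
    finally show "ennreal \<bar>D s\<bar> \<le> osgood_seminorm d m L (\<lambda>x. u x s) * ennreal (L (sep a b s))" .
  next
    have "continuous_on {p'..q'} (\<lambda>s. \<phi> c s i)" if "c \<in> Rn d" "i < d" for c i
      using flow_continuous_on_time[OF that] by (rule continuous_on_subset) (use I in auto)
    moreover have "continuous_on {p'..q'} (\<lambda>s. u (\<phi> c s) s i)" if "c \<in> Rn d" for c i
      using velocity_continuous_along_flow[OF that] by (rule continuous_on_subset) (use I in auto)
    moreover have "continuous_on {p'..q'} (sep a b)"
      using sep_continuous[OF assms(1,2)] by (rule continuous_on_subset) (use I in auto)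
    moreover have "sep a b s \<noteq> 0" if "s \<in> {p'..q'}" for s
      using range[OF that] by simp
    ultimately show "continuous_on {p'..q'} D"
      unfolding D_def using assms(1,2) by (intro continuous_intros) auto
  next
    have "(\<integral>\<^sup>+ s\<in>{p'..q'}. osgood_seminorm d m L (\<lambda>x. u x s) \<partial>lborel) \<le> velocity_integral d m L u t"
      unfolding velocity_integral_def using pq
      by (intro nn_integral_mono mult_left_mono) (auto simp: indicator_def)
    also have "\<dots> = ennreal (ln (mu d m L u t))"
      using assms by (simp add: ennreal_ln_mu)
    finally show "(\<integral>\<^sup>+ s\<in>{p'..q'}. osgood_seminorm d m L (\<lambda>x. u x s) \<partial>lborel) \<le> ennreal (ln (mu d m L u t))" .
  qed (rule ln_mu_nonneg)
qed

text \<open>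
  A separation starting at \<open>k\<close> cannot reach \<open>e\<close>: the budget \<open>log \<mu>(t)\<close> is too small for the gap
  \<open>\<M>(k) - \<M>(e)\<close>.
\<close>
lemma sep_stays_small:
  assumes "a \<in> Rn d" "b \<in> Rn d" "t \<in> {0..T}" "p \<in> {0..t}" "q \<in> {0..t}"
    and "sep a b p \<le> k" "0 < k" "k < m" "0 < e" "e < m" "Mfun L m e + ln (mu d m L u t) < Mfun L m k"
  shows "sep a b q < e"
proof (rule ccontr)
  assume "\<not> sep a b q < e"
  moreover have "k < e"
  proof (rule ccontr)
    assume "\<not> k < e"
    then have "Mfun L m k \<le> Mfun L m e"
      using Mfun_strict_antimono[OF modulus, of e k] assms by (cases "e = k") auto
    then show False using assms ln_mu_nonneg[of t] by linarith
  qed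
  ultimately show False
    using crossing_cost[of a b t p q k e] assms by linarith
qed

text \<open>
  The divergence \<open>\<M>(0+) = \<infinity>\<close> makes the gap as large as needed. Since \<open>p\<close> and \<open>q\<close> are unordered, this
  is at once equicontinuity of the flow maps and of their inverses.
\<close>
lemma sep_uniformly_small:
  assumes "0 < e" "t \<in> {0..T}"
  obtains k where "0 < k"
    "\<And>a b p q. a \<in> Rn d \<Longrightarrow> b \<in> Rn d \<Longrightarrow> p \<in> {0..t} \<Longrightarrow> q \<in> {0..t} \<Longrightarrow> sep a b p < k \<Longrightarrow> sep a b q < e"
proof -
  define e' where "e' = min e (m / 2)"
  have e': "0 < e'" "e' < m" "e' \<le> e"
    using assms m_pos by (auto simp: e'_def)
  obtain k where k: "0 < k" "k < m" "Mfun L m e' + ln (mu d m L u t) < Mfun L m k"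
    using Mfun_large_near_0[OF modulus m_pos] .
  show thesis
  proof (rule that[OF k(1)])
    fix a b p q
    assume "a \<in> Rn d" "b \<in> Rn d" "p \<in> {0..t}" "q \<in> {0..t}" "sep a b p < k"
    then have "sep a b q < e'"
      using sep_stays_small[of a b t p q k e'] k e' assms by simp
    then show "sep a b q < e" using e' by simp
  qed
qed

text \<open>
  Osgood uniqueness: if the lines met at time \<open>t\<close>, tracing them back would bring their starting
  points closer together than they are.
\<close>
lemma sep_pos:
  assumes "a \<in> Rn d" "b \<in> Rn d" "a \<noteq> b" "t \<in> {0..T}"
  shows "0 < sep a b t"
proof (rule ccontr)
  assume "\<not> 0 < sep a b t"
  then have "sep a b t = 0"
    using edist_nonneg[of d "\<phi> a t" "\<phi> b t"] by linarith
  moreover have "0 < edist d a b"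
    using assms edist_eq_0_iff[of a d b] edist_nonneg[of d a b] by linarith
  then obtain k where "0 < k" "\<And>p q. p \<in> {0..t} \<Longrightarrow> q \<in> {0..t} \<Longrightarrow> sep a b p < k \<Longrightarrow> sep a b q < edist d a b"
    using sep_uniformly_small[OF _ assms(4)] assms(1,2) by metis
  from this(1) this(2)[of t 0] have "sep a b t < k \<longrightarrow> sep a b 0 < edist d a b"
    using assms by simp
  ultimately show False
    using \<open>0 < k\<close> flow_0 assms by simp
qed

lemma flow_inj: "t \<in> {0..T} \<Longrightarrow> inj_on (\<lambda>a. \<phi> a t) (Rn d)"
  using sep_pos by (intro inj_onI) (metis edist_eq_0_iff flow_in_Rn less_irrefl)

lemma flow_continuous:
  assumes t: "t \<in> {0..T}"
  shows "continuous_on (Rn d) (\<lambda>a. \<phi> a t)"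
proof (rule continuous_on_coordinatewise_then_product)
  fix i
  show "continuous_on (Rn d) (\<lambda>a. \<phi> a t i)"
  proof (cases "i < d")
    case False
    then have "\<phi> a t i = 0" if "a \<in> Rn d" for a
      using flow_in_Rn[OF that t] by (simp add: topspace_Euclidean_space)
    then show ?thesis
      by (intro continuous_on_eq[OF continuous_on_const[of _ 0]]) simp
  next
    case True
    show ?thesis
      unfolding continuous_on_def
    proof (intro ballI tendstoI)
      fix a and e :: real
      assume a: "a \<in> Rn d" and "0 < e"
      then obtain k where k: "0 < k" "\<And>b. b \<in> Rn d \<Longrightarrow> sep b a 0 < k \<Longrightarrow> sep b a t < e"
        using sep_uniformly_small[OF \<open>0 < e\<close> t] t by (metis atLeastAtMost_iff order_refl)
      have "continuous_on UNIV (\<lambda>b. edist d b a)"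
        unfolding edist_def L2_set_def
        by (intro continuous_intros continuous_on_product_coordinates)
      then have "((\<lambda>b. edist d b a) \<longlongrightarrow> edist d a a) (at a within Rn d)"
        by (meson UNIV_I continuous_on_def continuous_on_subset subset_UNIV a)
      then have "eventually (\<lambda>b. edist d b a < k) (at a within Rn d)"
        by (rule order_tendstoD) (use k in \<open>simp add: edist_def L2_set_def\<close>)
      moreover have "eventually (\<lambda>b. b \<in> Rn d) (at a within Rn d)"
        by (simp add: eventually_at_filter)
      ultimately show "eventually (\<lambda>b. dist (\<phi> b t i) (\<phi> a t i) < e) (at a within Rn d)"
      proof eventually_elim
        case (elim b)
        then have "sep b a t < e"
          using k flow_0 a by simp
        then show ?case
          using abs_coordinate_le_edist[OF True, of "\<phi> b t" "\<phi> a t"] by (simp add: dist_real_def)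
      qed
    qed
  qed
qed

text \<open>
  A bounded velocity gives bounded displacement, so the topological criterion applies. This replaces
  solving the equation backwards in time.
\<close>
lemma flow_onto:
  assumes t: "t \<in> {0..T}"
  shows "(\<lambda>a. \<phi> a t) ` Rn d = Rn d"
proof -
  obtain K where K: "\<And>x t. x \<in> Rn d \<Longrightarrow> t \<in> {0..T} \<Longrightarrow> L2_set (u x t) {..<d} \<le> K"
    using velocity unfolding osgood_velocity_def by blast
  have "\<bar>\<phi> a t i - a i\<bar> \<le> K * t" if "a \<in> Rn d" "i < d" for a i
  proof -
    have "norm (u (\<phi> a s) s i) \<le> K" if s: "s \<in> {0..T}" for s
      using K[OF flow_in_Rn[OF \<open>a \<in> Rn d\<close> s] s] member_le_L2_set[of "{..<d}" i "\<lambda>i. \<bar>u (\<phi> a s) s i\<bar>"] \<open>i < d\<close>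
      by (simp add: L2_set_def)
    then have "norm (\<phi> a t i - \<phi> a 0 i) \<le> K * norm (t - 0)"
      using flow_derivative[OF that(1) _ that(2)] t T_pos
      by (intro field_differentiable_bound[of "{0..T}"]) auto
    then show ?thesis
      using flow_0 that t by simp
  qed
  then show ?thesis
    using flow_in_Rn t by (intro Rn_self_map_onto flow_continuous flow_inj) auto
qed

section \<open>Propagation of the singularity\<close>

lemma transport_solution_along_flow:
  assumes "x \<in> Rn d" "t \<in> {0..T}"
  obtains a where "a \<in> Rn d" "\<phi> a t = x" "transport_solution d \<phi> \<theta>0 x t = \<theta>0 a"
proof -
  have "x \<in> (\<lambda>a. \<phi> a t) ` Rn d"
    using flow_onto assms by simp
  from inv_into_into[OF this] f_inv_into_f[OF this] show thesis
    by (intro that[of "inv_into (Rn d) (\<lambda>a. \<phi> a t) x"]) (auto simp: transport_solution_def)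
qed

lemma Mfun_sep_variation_le:
  assumes "a \<in> Rn d" "b \<in> Rn d" "a \<noteq> b" "t \<in> {0..T}" "p \<in> {0..t}" "q \<in> {0..t}"
    and "sep a b p < m" "sep a b q < m"
  shows "\<bar>Mfun L m (sep a b p) - Mfun L m (sep a b q)\<bar> \<le> ln (mu d m L u t)"
proof -
  have one_sided: "Mfun L m (sep a b p') - Mfun L m (sep a b q') \<le> ln (mu d m L u t)
      \<and> Mfun L m (sep a b q') < Mfun L m (sep a b p')"
    if "p' \<in> {0..t}" "q' \<in> {0..t}" "sep a b q' < m" "sep a b p' < sep a b q'" for p' q'
  proof -
    have "0 < sep a b p'"
      using sep_pos[of a b p'] assms that by simp
    then show ?thesis
      using crossing_cost[of a b t p' q' "sep a b p'" "sep a b q'"] assms that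
        Mfun_strict_antimono[OF modulus, of "sep a b p'" "sep a b q'"] by simp
  qed
  consider "sep a b p < sep a b q" | "sep a b q < sep a b p" | "sep a b p = sep a b q"
    by linarith
  then show ?thesis
  proof cases
    case 1
    then show ?thesis using one_sided[of p q] assms by linarith
  next
    case 2
    then show ?thesis using one_sided[of q p] assms by linarith
  qed (use ln_mu_nonneg in simp)
qed

text \<open>
  Being closer than the shrunken radius at time \<open>t\<close> means that \<open>\<M>\<close> of the separation exceeds \<open>\<M>(r)\<close>
  by more than \<open>log \<mu>(t)\<close>. Going back to time \<open>0\<close> cannot use up that margin, so the starting points
  are within \<open>r\<close>.
\<close>
lemma sep_traced_back:
  assumes ab: "a \<in> Rn d" "b \<in> Rn d" "a \<noteq> b" and t: "t \<in> {0..T}"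
    and r: "0 < r" "r < m"
    and close: "sep a b t < Rinv L m (Rfun L m r / mu d m L u t)"
  shows "edist d a b < r" "Mfun L m r < Mfun L m (sep a b t)"
    and "\<bar>Mfun L m (edist d a b) - Mfun L m (sep a b t)\<bar> \<le> ln (mu d m L u t)"
proof -
  let ?\<rho> = "Rinv L m (Rfun L m r / mu d m L u t)"
  have "1 \<le> mu d m L u t" by (simp add: mu_def)
  note \<rho> = Rinv_shrunk_radius[OF modulus r this]
  have pos: "0 < sep a b t"
    using sep_pos ab t by blast
  then have far: "Mfun L m r + ln (mu d m L u t) < Mfun L m (sep a b t)"
    using Mfun_strict_antimono[OF modulus pos close] \<rho> by simp
  then show "Mfun L m r < Mfun L m (sep a b t)"
    using ln_mu_nonneg[of t] by linarith
  have sep0: "sep a b 0 = edist d a b"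
    using flow_0 ab by simp
  have "sep a b 0 < r"
    using sep_stays_small[of a b t t 0 "sep a b t" r] ab t pos close \<rho> r far by simp
  then show "edist d a b < r" by (simp add: sep0)
  then show "\<bar>Mfun L m (edist d a b) - Mfun L m (sep a b t)\<bar> \<le> ln (mu d m L u t)"
    using Mfun_sep_variation_le[of a b t 0 t] ab t close \<rho> r by (simp add: sep0)
qed

end

lemma Fnorm_Lipschitz:
  assumes F: "smooth_fun F" "Fnorm F < \<infinity>" and "1 \<le> y" "1 \<le> z"
  shows "ennreal \<bar>F y - F z\<bar> \<le> Fnorm F * ennreal \<bar>y - z\<bar>"
proof -
  have "(deriv ^^ 0) F differentiable_on UNIV"
    using F(1) unfolding smooth_fun_def by blast
  then have der: "(F has_real_derivative deriv F x) (at x within {1..})" for x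
    by (auto simp: differentiable_on_def intro!: has_field_derivative_at_within
        DERIV_deriv_iff_real_differentiable[THEN iffD2])
  have "norm (deriv F x) \<le> enn2real (Fnorm F)" if "x \<in> {1..}" for x
  proof -
    have "ennreal \<bar>deriv F x\<bar> \<le> Fnorm F"
      unfolding Fnorm_def by (rule SUP_upper) (use that in simp)
    then show ?thesis
      using enn2real_mono[of "ennreal \<bar>deriv F x\<bar>" "Fnorm F"] F(2) by simp
  qed
  then have "\<bar>F y - F z\<bar> \<le> enn2real (Fnorm F) * \<bar>y - z\<bar>"
    using field_differentiable_bound[of "{1..}" F "deriv F" "enn2real (Fnorm F)" y z] der assms
    by simp
  then have "ennreal \<bar>F y - F z\<bar> \<le> ennreal (enn2real (Fnorm F) * \<bar>y - z\<bar>)"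
    by (rule ennreal_leI)
  also have "\<dots> = Fnorm F * ennreal \<bar>y - z\<bar>"
    using F(2) by (simp add: ennreal_mult)
  finally show ?thesis .
qed

text \<open>
  With \<open>x = \<phi>(a,t)\<close> the remainder is \<open>b\<^sub>0(a) + F(\<M>(\<bar>a - x\<^sub>0\<bar>)) - F(\<M>(\<bar>x - \<phi>(x\<^sub>0,t)\<bar>))\<close>. Both arguments of
  \<open>F\<close> are at least \<open>\<M>(r) \<ge> 1\<close>, so they lie in one interval on which \<open>\<bar>F'\<bar> \<le> [F]\<close>.
\<close>
lemma (in osgood_flow) transport_remainder_le:
  assumes x0: "x0 \<in> Rn d" and r: "0 < r" "r < m" "1 \<le> Mfun L m r"
    and \<theta>0: "\<forall>x \<in> open_ball d x0 r - {x0}. \<theta>0 x = F (Mfun L m (edist d x x0)) + b0 x"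
    and F: "smooth_fun F" "Fnorm F < \<infinity>"
    and t: "t \<in> {0..T}"
    and x: "x \<in> open_ball d (\<phi> x0 t) (Rinv L m (Rfun L m r / mu d m L u t))" "x \<noteq> \<phi> x0 t"
  shows "ennreal \<bar>transport_solution d \<phi> \<theta>0 x t - F (Mfun L m (edist d x (\<phi> x0 t)))\<bar>
    \<le> Linf_norm (open_ball d x0 r) b0 + Fnorm F * ennreal (ln (mu d m L u t))"
proof -
  have xin: "x \<in> Rn d"
    using x by (simp add: open_ball_def)
  obtain a where a: "a \<in> Rn d" "\<phi> a t = x" "transport_solution d \<phi> \<theta>0 x t = \<theta>0 a"
    using transport_solution_along_flow[OF xin t] .
  have "a \<noteq> x0"
    using a x by blast
  have close: "sep a x0 t < Rinv L m (Rfun L m r / mu d m L u t)"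
    using x a by (simp add: open_ball_def)
  note traced = sep_traced_back[OF a(1) x0 \<open>a \<noteq> x0\<close> t r(1,2) close]
  let ?M0 = "Mfun L m (edist d a x0)" and ?Mt = "Mfun L m (edist d x (\<phi> x0 t))"
  have "0 < edist d a x0"
    using edist_eq_0_iff[OF a(1) x0] edist_nonneg[of d a x0] \<open>a \<noteq> x0\<close> by linarith
  then have "1 \<le> ?M0" "1 \<le> ?Mt"
    using Mfun_strict_antimono[OF modulus _ traced(1)] traced(2) r a(2) by auto
  then have "ennreal \<bar>F ?M0 - F ?Mt\<bar> \<le> Fnorm F * ennreal \<bar>?M0 - ?Mt\<bar>"
    using Fnorm_Lipschitz[OF F] by simp
  also have "\<dots> \<le> Fnorm F * ennreal (ln (mu d m L u t))"
    using traced(3) a(2) by (intro mult_left_mono ennreal_leI) auto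
  finally have osc: "ennreal \<bar>F ?M0 - F ?Mt\<bar> \<le> Fnorm F * ennreal (ln (mu d m L u t))" .
  have a_ball: "a \<in> open_ball d x0 r"
    using a traced by (simp add: open_ball_def)
  then have b0: "ennreal \<bar>b0 a\<bar> \<le> Linf_norm (open_ball d x0 r) b0"
    unfolding Linf_norm_def by (rule SUP_upper)
  have "transport_solution d \<phi> \<theta>0 x t - F ?Mt = b0 a + (F ?M0 - F ?Mt)"
    using a(3) \<theta>0 a_ball \<open>a \<noteq> x0\<close> by simp
  then have "ennreal \<bar>transport_solution d \<phi> \<theta>0 x t - F ?Mt\<bar> \<le> ennreal \<bar>b0 a\<bar> + ennreal \<bar>F ?M0 - F ?Mt\<bar>"
    by (simp add: ennreal_plus[symmetric] abs_triangle_ineq del: ennreal_plus)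
  also have "\<dots> \<le> Linf_norm (open_ball d x0 r) b0 + Fnorm F * ennreal (ln (mu d m L u t))"
    by (rule add_mono[OF b0 osc])
  finally show ?thesis .
qed

theorem theorem2:
  fixes L :: "real \<Rightarrow> real" and m T :: real
  assumes "osgood_modulus m L" and "0 < T"
  shows "\<exists>r0::real. 0 < r0 \<and> r0 < 1 \<and> r0 \<le> m \<and>
    (\<forall>(d::nat) (u :: (nat \<Rightarrow> real) \<Rightarrow> real \<Rightarrow> (nat \<Rightarrow> real)) (\<phi> :: (nat \<Rightarrow> real) \<Rightarrow> real \<Rightarrow> (nat \<Rightarrow> real))
        (x0 :: nat \<Rightarrow> real) (r::real) (\<theta>0 :: (nat \<Rightarrow> real) \<Rightarrow> real) (F :: real \<Rightarrow> real)
        (b0 :: (nat \<Rightarrow> real) \<Rightarrow> real) (B0::ennreal).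
      1 \<le> d \<longrightarrow>
      osgood_velocity d m L T u \<longrightarrow>
      is_flow d T u \<phi> \<longrightarrow>
      x0 \<in> Rn d \<longrightarrow> 0 < r \<longrightarrow> r < r0 \<longrightarrow>
      (\<forall>x \<in> open_ball d x0 r - {x0}. \<theta>0 x = F (Mfun L m (edist d x x0)) + b0 x) \<longrightarrow>
      Linf_norm (open_ball d x0 r) b0 \<le> B0 \<longrightarrow> B0 < \<infinity> \<longrightarrow>
      smooth_fun F \<longrightarrow> Fnorm F < \<infinity> \<longrightarrow>
      (\<exists>b :: (nat \<Rightarrow> real) \<Rightarrow> real \<Rightarrow> real.
         (\<exists>C::real. \<forall>t\<in>{0..T}. \<forall>x \<in> open_ball d (\<phi> x0 t) (Rinv L m (Rfun L m r / mu d m L u t)). \<bar>b x t\<bar> \<le> C) \<and>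
         (\<forall>t\<in>{0..T}.
            (\<forall>x \<in> open_ball d (\<phi> x0 t) (Rinv L m (Rfun L m r / mu d m L u t)) - {\<phi> x0 t}.
               transport_solution d \<phi> \<theta>0 x t = F (Mfun L m (edist d x (\<phi> x0 t))) + b x t) \<and>
            Linf_norm (open_ball d (\<phi> x0 t) (Rinv L m (Rfun L m r / mu d m L u t))) (\<lambda>x. b x t)
              \<le> Linf_norm (open_ball d x0 r) b0 + Fnorm F * ennreal (ln (mu d m L u t)))))"
proof -
  have "0 < min 1 m"
    using assms by (simp add: osgood_modulus_def)
  then obtain r0 where r0: "0 < r0" "r0 < min 1 m" "1 < Mfun L m r0"
    using Mfun_large_near_0[OF assms(1)] by blast
  show ?thesis
  proof (rule exI[of _ r0], intro conjI allI impI)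
    fix d u \<phi> x0 r \<theta>0 F b0 B0
    assume "1 \<le> d" and vel: "osgood_velocity d m L T u" and fl: "is_flow d T u \<phi>"
      and x0: "x0 \<in> Rn d" and r: "0 < r" "r < r0"
      and \<theta>0: "\<forall>x \<in> open_ball d x0 r - {x0}. \<theta>0 x = F (Mfun L m (edist d x x0)) + b0 x"
      and B0: "Linf_norm (open_ball d x0 r) b0 \<le> B0" "B0 < \<infinity>"
      and F: "smooth_fun F" "Fnorm F < \<infinity>"
    interpret osgood_flow d m L T u \<phi>
      using assms vel fl by unfold_locales
    have "r < m"
      using r r0 by simp
    have "1 \<le> Mfun L m r"
      using Mfun_strict_antimono[OF assms(1) r] r0 by simp
    let ?ball = "\<lambda>t. open_ball d (\<phi> x0 t) (Rinv L m (Rfun L m r / mu d m L u t))"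
    let ?bound = "\<lambda>t. Linf_norm (open_ball d x0 r) b0 + Fnorm F * ennreal (ln (mu d m L u t))"
    \<comment> \<open>At the centre \<open>\<M>\<close> is infinite and no representation is claimed there, yet the supremum
      includes this point; the value \<open>0\<close> is harmless.\<close>
    define b where "b x t = (if x = \<phi> x0 t then 0
        else transport_solution d \<phi> \<theta>0 x t - F (Mfun L m (edist d x (\<phi> x0 t))))" for x t
    have b_le: "ennreal \<bar>b x t\<bar> \<le> ?bound t" if "t \<in> {0..T}" "x \<in> ?ball t" for x t
      using transport_remainder_le[OF x0 r(1) \<open>r < m\<close> \<open>1 \<le> Mfun L m r\<close> \<theta>0 F that]
      by (simp add: b_def)
    have "?bound T < \<infinity>"
      using B0 F(2) by (auto simp: ennreal_mult_less_top intro: le_less_trans)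
    have "\<bar>b x t\<bar> \<le> enn2real (?bound T)" if t: "t \<in> {0..T}" and x: "x \<in> ?ball t" for x t
    proof -
      have "?bound t \<le> ?bound T"
        using t by (intro add_left_mono mult_left_mono ennreal_leI ln_mu_mono) auto
      then have "ennreal \<bar>b x t\<bar> \<le> ?bound T"
        using b_le[OF t x] by (rule order.trans[rotated])
      from enn2real_mono[OF this] \<open>?bound T < \<infinity>\<close> show ?thesis by simp
    qed
    moreover have "Linf_norm (?ball t) (\<lambda>x. b x t) \<le> ?bound t" if "t \<in> {0..T}" for t
      unfolding Linf_norm_def[of "?ball t"] using b_le[OF that] by (rule SUP_least)
    ultimately show "\<exists>b. (\<exists>C::real. \<forall>t\<in>{0..T}. \<forall>x \<in> ?ball t. \<bar>b x t\<bar> \<le> C) \<and>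
         (\<forall>t\<in>{0..T}.
            (\<forall>x \<in> ?ball t - {\<phi> x0 t}.
               transport_solution d \<phi> \<theta>0 x t = F (Mfun L m (edist d x (\<phi> x0 t))) + b x t) \<and>
            Linf_norm (?ball t) (\<lambda>x. b x t) \<le> ?bound t)"
      by (intro exI[of _ b] conjI ballI exI[of _ "enn2real (?bound T)"]) (auto simp: b_def)
  qed (use r0 in auto)
qed

end
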